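(* Let $M=(E,\mathcal I)$ be a finite matroid with $|E|=n$. Then for any $f\in\mathrm{Hom}_d(n)$: (i) $\widehat T_f(M)=\widehat T_f(M;x,y)=\sum_{s\in S(M)}T_f(M(s);x,y)$ is an invariant for matroids. (ii) Let $R(f)=\sum_{\sigma\in S_n}\sigma f$. Then $T_{R(f)}(M(s))$ is independent of the choice of the label $s$ of $M$; denoting it by $T_{R(f)}(M)$, it is an invariant for matroids. Moreover, $\widehat T_f(M)=T_{R(f)}(M)$. (iii) Suppose $\sigma f=f$ for all $\sigma\in S_n$. Then $T_f(M)$ (the common value of $T_f(M(s))$ over all labels $s$) is an invariant for matroids, and $\widehat T_f(M)=n!\,T_f(M)$.
   Context: "Invariant for matroids" means that isomorphic matroids have the same value. Let $\Omega=\{1,\dots,n\}$ and $\Omega_d=\{Z\subset\Omega:|Z|=d\}$. $\mathrm{Hom}_d(n)=\mathbb R\Omega_d$ is the space of formal sums $f=\sum_{Z\in\Omega_d}f(Z)Z$, identified with functions $f:\Omega_d\to\mathbb R$. The symmetric group $S_n$ acts linearly on $\mathrm{Hom}_d(n)$ by permuting subsets: $\sigma f=\sum_{Z}f(Z)\,\sigma(Z)$. For $X\subset\Omega$ put $\widetilde f(X)=\sum_{Z\in\Omega_d,\,Z\subset X}f(Z)$. A label of $M$ is a bijection $s:E\to\Omega$; $S(M)$ is the set of all $n!$ labels. With $\rho$ the rank function of $M$, the weighted Tutte polynomial is $$T_f(M(s))=T_f(M(s);x,y)=\sum_{A\subset E}\widetilde f(s(A))(x-1)^{\rho(E)-\rho(A)}(y-1)^{|A|-\rho(A)}.$$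 *)

theory Defs
  imports
    "HOL-Library.FuncSet"
    "HOL-Combinatorics.Permutations"
    "HOL-Computational_Algebra.Polynomial"
begin

locale finite_matroid =
  fixes E :: "'a set" and \<I> :: "'a set set"
  assumes finite_ground: "finite E"
    and indep_subset_ground: "\<And>I. I \<in> \<I> \<Longrightarrow> I \<subseteq> E"
    and indep_empty: "{} \<in> \<I>"
    and indep_hereditary: "\<And>I J. J \<in> \<I> \<Longrightarrow> I \<subseteq> J \<Longrightarrow> I \<in> \<I>"
    and indep_augment:
      "\<And>I J. I \<in> \<I> \<Longrightarrow> J \<in> \<I> \<Longrightarrow> card I < card J \<Longrightarrow> \<exists>e \<in> J - I. insert e I \<in> \<I>"

definition matroid_rank :: "'a set set \<Rightarrow> 'a set \<Rightarrow> nat" where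
  "matroid_rank \<I> A = Max (card ` {I \<in> \<I>. I \<subseteq> A})"

definition matroid_iso :: "'a set \<Rightarrow> 'a set set \<Rightarrow> 'b set \<Rightarrow> 'b set set \<Rightarrow> bool" where
  "matroid_iso E \<I> E' \<I>' \<longleftrightarrow>
     (\<exists>\<phi>. bij_betw \<phi> E E' \<and> (\<forall>X. X \<subseteq> E \<longrightarrow> (X \<in> \<I> \<longleftrightarrow> \<phi> ` X \<in> \<I>')))"

definition Omega :: "nat \<Rightarrow> nat \<Rightarrow> nat set set" where
  "Omega n d = {Z. Z \<subseteq> {1..n} \<and> card Z = d}"

text \<open>Functions on \<^term>\<open>Omega n d\<close> are represented as functions on all sets of naturals that
  vanish outside \<^term>\<open>Omega n d\<close>, so that equality of functions is equality in the space.\<close>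

definition Hom :: "nat \<Rightarrow> nat \<Rightarrow> (nat set \<Rightarrow> real) set" where
  "Hom n d = {f. \<forall>Z. Z \<notin> Omega n d \<longrightarrow> f Z = 0}"

text \<open>The formal sum of the terms \<open>f(Z) \<sigma>(Z)\<close>: its coefficient at \<open>W\<close> collects the \<open>f(Z)\<close> with
  \<open>\<sigma>(Z) = W\<close>.\<close>

definition perm_act :: "nat \<Rightarrow> nat \<Rightarrow> (nat \<Rightarrow> nat) \<Rightarrow> (nat set \<Rightarrow> real) \<Rightarrow> nat set \<Rightarrow> real" where
  "perm_act n d \<sigma> f = (\<lambda>W. \<Sum>Z\<in>Omega n d. f Z * (if \<sigma> ` Z = W then 1 else 0))"

definition symmetrize :: "nat \<Rightarrow> nat \<Rightarrow> (nat set \<Rightarrow> real) \<Rightarrow> nat set \<Rightarrow> real" where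
  "symmetrize n d f = (\<lambda>W. \<Sum>\<sigma> | \<sigma> permutes {1..n}. perm_act n d \<sigma> f W)"

definition tilde :: "nat \<Rightarrow> nat \<Rightarrow> (nat set \<Rightarrow> real) \<Rightarrow> nat set \<Rightarrow> real" where
  "tilde n d f X = (\<Sum>Z | Z \<in> Omega n d \<and> Z \<subseteq> X. f Z)"

text \<open>Labels are taken extensional outside \<open>E\<close>, so that each bijection from \<open>E\<close> to \<open>{1..n}\<close> is
  counted exactly once.\<close>

definition labels :: "nat \<Rightarrow> 'a set \<Rightarrow> ('a \<Rightarrow> nat) set" where
  "labels n E = {s \<in> extensional E. bij_betw s E {1..n}}"

text \<open>The ring of real polynomials in \<open>x\<close> and \<open>y\<close> is \<^typ>\<open>real poly poly\<close>, with \<open>y\<close> the outer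
  variable.\<close>

definition var_x :: "real poly poly" where
  "var_x = [:[:0, 1:]:]"

definition var_y :: "real poly poly" where
  "var_y = [:0, 1:]"

definition weighted_tutte ::
  "nat \<Rightarrow> nat \<Rightarrow> (nat set \<Rightarrow> real) \<Rightarrow> 'a set \<Rightarrow> 'a set set \<Rightarrow> ('a \<Rightarrow> nat) \<Rightarrow> real poly poly" where
  "weighted_tutte n d f E \<I> s =
     (\<Sum>A\<in>Pow E. [:[:tilde n d f (s ` A):]:]
        * (var_x - 1) ^ (matroid_rank \<I> E - matroid_rank \<I> A)
        * (var_y - 1) ^ (card A - matroid_rank \<I> A))"

definition weighted_tutte_hat ::
  "nat \<Rightarrow> nat \<Rightarrow> (nat set \<Rightarrow> real) \<Rightarrow> 'a set \<Rightarrow> 'a set set \<Rightarrow> real poly poly" where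
  "weighted_tutte_hat n d f E \<I> = (\<Sum>s\<in>labels n E. weighted_tutte n d f E \<I> s)"

text \<open>The common value over all labels; only meaningful when the weighted Tutte polynomial does not
  depend on the label.\<close>

definition weighted_tutte_common ::
  "nat \<Rightarrow> nat \<Rightarrow> (nat set \<Rightarrow> real) \<Rightarrow> 'a set \<Rightarrow> 'a set set \<Rightarrow> real poly poly" where
  "weighted_tutte_common n d f E \<I> =
     (THE p. \<forall>s\<in>labels n E. weighted_tutte n d f E \<I> s = p)"

end

theory Submission
  imports Defs
begin

text \<open>The symmetric group acts freely and transitively on the labels, and
  \<open>T\<^bsub>\<sigma>f\<^esub>(M(\<sigma>s)) = T\<^sub>f(M(s))\<close>. As \<open>T\<^sub>f\<close> is linear in \<open>f\<close>, summing over \<open>\<sigma>\<close> shows that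
  \<open>T\<^bsub>R(f)\<^esub>(M(s))\<close> is the sum of \<open>T\<^sub>f\<close> over all labels, whatever \<open>s\<close> is. An isomorphism of matroids
  preserves ranks and induces a bijection between the labels, so this sum is an invariant. For
  symmetric \<open>f\<close>, \<open>R(f) = n! f\<close>, and \<open>n!\<close> can be cancelled.\<close>

section \<open>Labels under bijections of the ground set and under permutations\<close>

text \<open>Pulling labels back along \<open>\<phi>\<close> is undone by pulling back along its
  inverse. The outer \<open>restrict\<close> keeps the composites extensional, so that each label is
  still counted once.\<close>

lemma bij_betw_restrict_comp_labels:
  assumes "bij_betw \<phi> E E'"
  shows "bij_betw (\<lambda>s. restrict (s \<circ> \<phi>) E) (labels n E') (labels n E)"
proof (rule bij_betw_byWitness[where f' = "\<lambda>s. restrict (s \<circ> inv_into E \<phi>) E'"])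
  have inv: "bij_betw (inv_into E \<phi>) E' E"
    by (rule bij_betw_inv_into[OF assms])
  show "\<forall>s\<in>labels n E'. restrict (restrict (s \<circ> \<phi>) E \<circ> inv_into E \<phi>) E' = s"
    using assms inv unfolding labels_def
    by (auto intro!: extensionalityI[where A = E'] simp: bij_betw_inv_into_right bij_betwE)
  show "\<forall>s\<in>labels n E. restrict (restrict (s \<circ> inv_into E \<phi>) E' \<circ> \<phi>) E = s"
    using assms inv unfolding labels_def
    by (auto intro!: extensionalityI[where A = E] simp: bij_betw_inv_into_left bij_betwE)
  show "(\<lambda>s. restrict (s \<circ> \<phi>) E) ` labels n E' \<subseteq> labels n E"
    using assms unfolding labels_def
    by (auto intro: bij_betw_trans)
  show "(\<lambda>s. restrict (s \<circ> inv_into E \<phi>) E') ` labels n E \<subseteq> labels n E'"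
    using inv unfolding labels_def
    by (auto intro: bij_betw_trans)
qed

text \<open>A fixed base label \<open>s\<close> turns sums over labels into sums over permutations.
  Two permutations with the same composite agree on \<open>{1..n}\<close>, since \<open>s\<close> is
  onto, and both fix everything else.\<close>

lemma bij_betw_permutes_labels:
  assumes s: "s \<in> labels n E"
  shows "bij_betw (\<lambda>\<sigma>. restrict (\<sigma> \<circ> s) E) {\<sigma>. \<sigma> permutes {1..n}} (labels n E)"
proof (rule bij_betw_imageI)
  have bij: "bij_betw s E {1..n}"
    using s by (simp add: labels_def)
  show "inj_on (\<lambda>\<sigma>. restrict (\<sigma> \<circ> s) E) {\<sigma>. \<sigma> permutes {1..n}}"
  proof (rule inj_onI)
    fix \<sigma> \<tau>
    assume "\<sigma> \<in> {\<sigma>. \<sigma> permutes {1..n}}" "\<tau> \<in> {\<sigma>. \<sigma> permutes {1..n}}"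
      and eq: "restrict (\<sigma> \<circ> s) E = restrict (\<tau> \<circ> s) E"
    then have perm: "\<sigma> permutes {1..n}" "\<tau> permutes {1..n}" by auto
    show "\<sigma> = \<tau>"
    proof
      fix i
      show "\<sigma> i = \<tau> i"
      proof (cases "i \<in> {1..n}")
        case True
        then obtain e where "e \<in> E" "s e = i"
          using bij by (metis bij_betw_imp_surj_on imageE)
        then show ?thesis
          using fun_cong[OF eq, of e] by auto
      next
        case False
        then show ?thesis
          using perm by (metis permutes_not_in)
      qed
    qed
  qed
  show "(\<lambda>\<sigma>. restrict (\<sigma> \<circ> s) E) ` {\<sigma>. \<sigma> permutes {1..n}} = labels n E"
  proof (intro equalityI subsetI)
    fix t
    assume "t \<in> (\<lambda>\<sigma>. restrict (\<sigma> \<circ> s) E) ` {\<sigma>. \<sigma> permutes {1..n}}"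
    then show "t \<in> labels n E"
      using bij by (auto simp: labels_def simp del: One_nat_def
          intro: bij_betw_trans[OF _ permutes_imp_bij])
  next
    fix t
    assume t: "t \<in> labels n E"
    \<comment> \<open>The only candidate on \<open>{1..n}\<close> is \<open>t\<close> after the
      inverse of \<open>s\<close>. Outside it must be the identity, as \<open>permutes\<close>
      demands.\<close>
    define \<sigma> where "\<sigma> i = (if i \<in> {1..n} then t (inv_into E s i) else i)" for i
    have "bij_betw (t \<circ> inv_into E s) {1..n} {1..n}"
      using t bij by (auto simp: labels_def intro: bij_betw_trans bij_betw_inv_into)
    then have "bij_betw \<sigma> {1..n} {1..n}"
      by (rule iffD1[OF bij_betw_cong, rotated]) (simp add: \<sigma>_def)
    then have "\<sigma> permutes {1..n}"
      by (rule bij_imp_permutes) (auto simp: \<sigma>_def)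
    moreover have "restrict (\<sigma> \<circ> s) E = t"
    proof (rule extensionalityI)
      show "t \<in> extensional E"
        using t by (simp add: labels_def)
      fix e
      assume e: "e \<in> E"
      then have "s e \<in> {1..n}"
        using bij by (rule bij_betwE[rule_format, rotated])
      then show "restrict (\<sigma> \<circ> s) E e = t e"
        using e bij_betw_inv_into_left[OF bij e] by (simp add: \<sigma>_def)
    qed simp
    ultimately show "t \<in> (\<lambda>\<sigma>. restrict (\<sigma> \<circ> s) E) ` {\<sigma>. \<sigma> permutes {1..n}}"
      by blast
  qed
qed

lemma labels_nonempty:
  assumes "finite E" and "card E = n"
  shows "labels n E \<noteq> {}"
proof -
  obtain h where "bij_betw h E {1..n}"
    using finite_same_card_bij[of E "{1..n}"] assms by auto
  then have "restrict h E \<in> labels n E"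
    by (simp add: labels_def)
  then show ?thesis by blast
qed

section \<open>The permutation action and the weights\<close>

lemma finite_Omega [simp]: "finite (Omega n d)"
  by (rule finite_subset[of _ "Pow {1..n}"]) (auto simp: Omega_def)

text \<open>By injectivity no other set has the image of \<open>Z\<close>, so the formal sum
  collapses to a single term.\<close>

lemma perm_act_image:
  assumes "inj \<sigma>" and "Z \<in> Omega n d"
  shows "perm_act n d \<sigma> f (\<sigma> ` Z) = f Z"
proof -
  have "perm_act n d \<sigma> f (\<sigma> ` Z) = (\<Sum>Y\<in>Omega n d. if Y = Z then f Y else 0)"
    unfolding perm_act_def using assms(1) by (intro sum.cong) (auto simp: inj_image_eq_iff)
  then show ?thesis
    using assms(2) by simp
qed

text \<open>A permutation of \<open>{1..n}\<close> preserves cardinalities and inclusion in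
  \<open>{1..n}\<close>. Hence the index sets below the image of \<open>X\<close> are exactly the
  images of those below \<open>X\<close>, and they carry the same coefficients.\<close>

lemma tilde_perm_act:
  assumes "\<sigma> permutes {1..n}"
  shows "tilde n d (perm_act n d \<sigma> f) (\<sigma> ` X) = tilde n d f X"
proof -
  have inj: "inj \<sigma>" and surj: "surj \<sigma>"
    using assms by (simp_all add: permutes_inj permutes_surj)
  have iff: "\<sigma> ` Z \<in> Omega n d \<longleftrightarrow> Z \<in> Omega n d" for Z
  proof -
    have "\<sigma> ` Z \<subseteq> {1..n} \<longleftrightarrow> Z \<subseteq> {1..n}"
      using inj_image_subset_iff[OF inj, of Z "{1..n}"] permutes_image[OF assms] by simp
    moreover have "card (\<sigma> ` Z) = card Z"
      using inj by (intro card_image) (auto intro: inj_on_subset)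
    ultimately show ?thesis by (simp add: Omega_def)
  qed
  have set_eq: "{Z. Z \<in> Omega n d \<and> Z \<subseteq> \<sigma> ` X} = (`) \<sigma> ` {Z. Z \<in> Omega n d \<and> Z \<subseteq> X}"
  proof (intro equalityI subsetI)
    fix W
    assume W: "W \<in> {Z. Z \<in> Omega n d \<and> Z \<subseteq> \<sigma> ` X}"
    then obtain Z where "Z \<subseteq> X" "W = \<sigma> ` Z"
      by (auto simp: subset_image_iff)
    then show "W \<in> (`) \<sigma> ` {Z. Z \<in> Omega n d \<and> Z \<subseteq> X}"
      using W iff by auto
  qed (use iff in auto)
  have "inj_on ((`) \<sigma>) {Z. Z \<in> Omega n d \<and> Z \<subseteq> X}"
    using inj by (auto simp: inj_on_def inj_image_eq_iff)
  then show ?thesis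
    unfolding tilde_def set_eq
    by (subst sum.reindex) (auto intro!: sum.cong simp: perm_act_image[OF inj])
qed

text \<open>Moves the action from \<open>f\<close> to the label. Ranks and cardinalities do not see
  the label, so only the weights have to be compared.\<close>

lemma weighted_tutte_perm_act:
  assumes "\<sigma> permutes {1..n}"
  shows "weighted_tutte n d (perm_act n d \<sigma> f) E \<I> s
           = weighted_tutte n d f E \<I> (restrict (inv \<sigma> \<circ> s) E)"
  unfolding weighted_tutte_def
proof (intro sum.cong refl)
  fix A
  assume "A \<in> Pow E"
  then have "restrict (inv \<sigma> \<circ> s) E ` A = inv \<sigma> ` (s ` A)"
    by (force simp: image_iff)
  moreover have "\<sigma> ` (inv \<sigma> ` (s ` A)) = s ` A"
    by (simp add: image_image permutes_inverses[OF assms])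
  ultimately have "tilde n d (perm_act n d \<sigma> f) (s ` A)
      = tilde n d f (restrict (inv \<sigma> \<circ> s) E ` A)"
    using tilde_perm_act[OF assms, of d f "inv \<sigma> ` (s ` A)"] by simp
  then show "[:[:tilde n d (perm_act n d \<sigma> f) (s ` A):]:]
        * (var_x - 1) ^ (matroid_rank \<I> E - matroid_rank \<I> A)
        * (var_y - 1) ^ (card A - matroid_rank \<I> A)
      = [:[:tilde n d f (restrict (inv \<sigma> \<circ> s) E ` A):]:]
        * (var_x - 1) ^ (matroid_rank \<I> E - matroid_rank \<I> A)
        * (var_y - 1) ^ (card A - matroid_rank \<I> A)"
    by simp
qed

section \<open>Linearity in the weight and symmetrization\<close>

lemma sum_const_poly: "(\<Sum>i\<in>S. [:g i:]) = [:sum g S:]"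
  by (induction S rule: infinite_finite_induct) simp_all

text \<open>Only the factor \<open>tilde\<close> depends on the weight, and it is additive. The sum
  over \<open>S\<close> passes through both layers of constant polynomials and is then exchanged
  with the sum over subsets of \<open>E\<close>.\<close>

lemma weighted_tutte_sum:
  "weighted_tutte n d (\<lambda>W. \<Sum>i\<in>S. g i W) E \<I> s = (\<Sum>i\<in>S. weighted_tutte n d (g i) E \<I> s)"
proof -
  have "tilde n d (\<lambda>W. \<Sum>i\<in>S. g i W) X = (\<Sum>i\<in>S. tilde n d (g i) X)" for X
    unfolding tilde_def by (rule sum.swap)
  then show ?thesis
    unfolding weighted_tutte_def
    by (subst sum.swap) (simp flip: sum_const_poly add: sum_distrib_right)
qed

text \<open>The right-hand side does not mention \<open>s\<close>, so this yields both the
  independence of the label and the comparison with the sum over all labels.\<close>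

lemma weighted_tutte_symmetrize_eq_hat:
  assumes "s \<in> labels n E"
  shows "weighted_tutte n d (symmetrize n d f) E \<I> s = weighted_tutte_hat n d f E \<I>"
proof -
  let ?P = "{\<sigma>. \<sigma> permutes {1..n}}"
  let ?T = "\<lambda>\<sigma>. weighted_tutte n d f E \<I> (restrict (\<sigma> \<circ> s) E)"
  have "weighted_tutte n d (symmetrize n d f) E \<I> s = (\<Sum>\<sigma>\<in>?P. ?T (inv \<sigma>))"
    unfolding symmetrize_def weighted_tutte_sum
    by (intro sum.cong) (auto simp: weighted_tutte_perm_act)
  \<comment> \<open>Inversion is a bijection of the symmetric group.\<close>
  also have "\<dots> = (\<Sum>\<sigma>\<in>?P. ?T \<sigma>)"
    by (rule sum_permutations_inverse[symmetric])
  also have "\<dots> = weighted_tutte_hat n d f E \<I>"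
    unfolding weighted_tutte_hat_def
    by (rule sum.reindex_bij_betw[OF bij_betw_permutes_labels[OF assms]])
  finally show ?thesis .
qed

text \<open>For invariant \<open>f\<close> each of the n! summands of
  \<open>symmetrize n d f\<close> is \<open>f\<close> itself.\<close>

lemma fact_weighted_tutte_eq_hat:
  assumes "s \<in> labels n E" and "\<And>\<sigma>. \<sigma> permutes {1..n} \<Longrightarrow> perm_act n d \<sigma> f = f"
  shows "of_nat (fact n) * weighted_tutte n d f E \<I> s = weighted_tutte_hat n d f E \<I>"
proof -
  have "weighted_tutte_hat n d f E \<I> = weighted_tutte n d (symmetrize n d f) E \<I> s"
    by (simp only: weighted_tutte_symmetrize_eq_hat[OF assms(1)])
  also have "\<dots> = (\<Sum>\<sigma> | \<sigma> permutes {1..n}. weighted_tutte n d f E \<I> s)"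
    unfolding symmetrize_def weighted_tutte_sum by (intro sum.cong) (simp_all add: assms(2))
  also have "\<dots> = of_nat (fact n) * weighted_tutte n d f E \<I> s"
    by (simp add: card_permutations[where n = n])
  finally show ?thesis by simp
qed

text \<open>Nonemptiness supplies uniqueness: without labels every polynomial would satisfy the
  description.\<close>

lemma weighted_tutte_common_eqI:
  assumes "labels n E \<noteq> {}" and "\<And>s. s \<in> labels n E \<Longrightarrow> weighted_tutte n d f E \<I> s = p"
  shows "weighted_tutte_common n d f E \<I> = p"
  unfolding weighted_tutte_common_def using assms by (intro the_equality) auto

section \<open>Invariance under matroid isomorphism\<close>

lemma matroid_rank_image:
  assumes bij: "bij_betw \<phi> E E'"
    and indep: "\<And>X. X \<subseteq> E \<Longrightarrow> X \<in> \<I> \<longleftrightarrow> \<phi> ` X \<in> \<I>'"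
    and "A \<subseteq> E"
  shows "matroid_rank \<I>' (\<phi> ` A) = matroid_rank \<I> A"
proof -
  have sets: "{J \<in> \<I>'. J \<subseteq> \<phi> ` A} = (`) \<phi> ` {I \<in> \<I>. I \<subseteq> A}"
  proof (intro equalityI subsetI)
    fix J
    assume J: "J \<in> {J \<in> \<I>'. J \<subseteq> \<phi> ` A}"
    then obtain I where "I \<subseteq> A" "J = \<phi> ` I"
      by (auto simp: subset_image_iff)
    then show "J \<in> (`) \<phi> ` {I \<in> \<I>. I \<subseteq> A}"
      using J indep[of I] \<open>A \<subseteq> E\<close> by auto
  next
    fix J
    assume "J \<in> (`) \<phi> ` {I \<in> \<I>. I \<subseteq> A}"
    then obtain I where I: "I \<in> \<I>" "I \<subseteq> A" "J = \<phi> ` I" by auto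
    then have "J \<in> \<I>'"
      using indep[of I] \<open>A \<subseteq> E\<close> by auto
    then show "J \<in> {J \<in> \<I>'. J \<subseteq> \<phi> ` A}"
      using I by auto
  qed
  have "card (\<phi> ` I) = card I" if "I \<subseteq> A" for I
    using bij that \<open>A \<subseteq> E\<close> by (intro card_image) (auto simp: bij_betw_def intro: inj_on_subset)
  then have "card ` {J \<in> \<I>'. J \<subseteq> \<phi> ` A} = card ` {I \<in> \<I>. I \<subseteq> A}"
    unfolding sets image_image by (intro image_cong) auto
  then show ?thesis
    by (simp add: matroid_rank_def)
qed

text \<open>Corresponding subsets have equal rank, equal cardinality and the same image in the
  naturals, so the two sums agree term by term.\<close>

lemma weighted_tutte_transport:
  assumes bij: "bij_betw \<phi> E E'"
    and indep: "\<And>X. X \<subseteq> E \<Longrightarrow> X \<in> \<I> \<longleftrightarrow> \<phi> ` X \<in> \<I>'"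
  shows "weighted_tutte n d f E \<I> (restrict (s \<circ> \<phi>) E) = weighted_tutte n d f E' \<I>' s"
proof -
  have rank: "matroid_rank \<I>' (\<phi> ` A) = matroid_rank \<I> A" if "A \<subseteq> E" for A
    by (rule matroid_rank_image[OF bij indep that])
  have rank_E: "matroid_rank \<I>' E' = matroid_rank \<I> E"
    using rank[of E] bij_betw_imp_surj_on[OF bij] by simp
  have card: "card (\<phi> ` A) = card A" if "A \<subseteq> E" for A
    using bij that by (intro card_image) (auto simp: bij_betw_def intro: inj_on_subset)
  have image: "restrict (s \<circ> \<phi>) E ` A = s ` \<phi> ` A" if "A \<subseteq> E" for A
    using that by (force simp: image_iff)
  show ?thesis
    unfolding weighted_tutte_def
    \<comment> \<open>The right-hand sum over subsets of \<open>E'\<close> is rewritten as a sum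
      over subsets of \<open>E\<close>.\<close>
    by (subst sum.reindex_bij_betw[OF bij_betw_Pow[OF bij], symmetric])
       (intro sum.cong refl, simp only: Pow_iff rank rank_E card image)
qed

lemma weighted_tutte_hat_iso:
  assumes "matroid_iso E \<I> E' \<I>'"
  shows "weighted_tutte_hat n d f E \<I> = weighted_tutte_hat n d f E' \<I>'"
proof -
  obtain \<phi> where bij: "bij_betw \<phi> E E'"
    and indep: "\<And>X. X \<subseteq> E \<Longrightarrow> X \<in> \<I> \<longleftrightarrow> \<phi> ` X \<in> \<I>'"
    using assms unfolding matroid_iso_def by blast
  have "weighted_tutte_hat n d f E \<I>
      = (\<Sum>s\<in>labels n E'. weighted_tutte n d f E \<I> (restrict (s \<circ> \<phi>) E))"
    unfolding weighted_tutte_hat_def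
    by (rule sum.reindex_bij_betw[OF bij_betw_restrict_comp_labels[OF bij], symmetric])
  also have "\<dots> = weighted_tutte_hat n d f E' \<I>'"
    unfolding weighted_tutte_hat_def by (simp only: weighted_tutte_transport[OF bij indep])
  finally show ?thesis .
qed

section \<open>The common value over all labels\<close>

text \<open>The label sets are in bijection, so the target has labels as soon as the source does;
  its elements need not be counted.\<close>

lemma matroid_iso_labels_nonempty:
  assumes "matroid_iso E \<I> E' \<I>'" and "labels n E \<noteq> {}"
  shows "labels n E' \<noteq> {}"
  using assms unfolding matroid_iso_def
  by (metis bij_betw_restrict_comp_labels bij_betw_empty1 bij_betw_empty2)

lemma weighted_tutte_common_symmetrize:
  assumes "labels n E \<noteq> {}"
  shows "weighted_tutte_common n d (symmetrize n d f) E \<I> = weighted_tutte_hat n d f E \<I>"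
  using assms by (rule weighted_tutte_common_eqI) (rule weighted_tutte_symmetrize_eq_hat)

text \<open>After multiplication by n! the values at any two labels equal the same sum over labels.
  The polynomial ring is a domain of characteristic zero, so n! cancels.\<close>

lemma weighted_tutte_eq_common:
  assumes s: "s \<in> labels n E" and sym: "\<And>\<sigma>. \<sigma> permutes {1..n} \<Longrightarrow> perm_act n d \<sigma> f = f"
  shows "weighted_tutte n d f E \<I> s = weighted_tutte_common n d f E \<I>"
proof (rule weighted_tutte_common_eqI[symmetric])
  fix t
  assume "t \<in> labels n E"
  then have "of_nat (fact n) * weighted_tutte n d f E \<I> t
      = of_nat (fact n) * weighted_tutte n d f E \<I> s"
    by (simp only: fact_weighted_tutte_eq_hat s sym)
  moreover have "(of_nat (fact n) :: real poly poly) \<noteq> 0"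
    by (simp only: of_nat_eq_0_iff fact_nonzero not_False_eq_True)
  ultimately show "weighted_tutte n d f E \<I> t = weighted_tutte n d f E \<I> s"
    by (rule mult_left_cancel[THEN iffD1, rotated])
\<comment> \<open>The remaining goal is that labels exist, witnessed by \<open>s\<close>.\<close>
qed (use s in blast)

lemma fact_weighted_tutte_common_eq_hat:
  assumes "labels n E \<noteq> {}" and "\<And>\<sigma>. \<sigma> permutes {1..n} \<Longrightarrow> perm_act n d \<sigma> f = f"
  shows "of_nat (fact n) * weighted_tutte_common n d f E \<I> = weighted_tutte_hat n d f E \<I>"
proof -
  obtain s where s: "s \<in> labels n E"
    using assms(1) by blast
  show ?thesis
    using fact_weighted_tutte_eq_hat[OF s assms(2)] weighted_tutte_eq_common[OF s assms(2)]
    by simp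
qed

text \<open>Invariance is inherited from \<open>weighted_tutte_hat\<close>, which is n! times the
  common value on either side.\<close>

lemma weighted_tutte_common_iso:
  assumes iso: "matroid_iso E \<I> E' \<I>'" and ne: "labels n E \<noteq> {}"
    and sym: "\<And>\<sigma>. \<sigma> permutes {1..n} \<Longrightarrow> perm_act n d \<sigma> f = f"
  shows "weighted_tutte_common n d f E \<I> = weighted_tutte_common n d f E' \<I>'"
proof -
  have "of_nat (fact n) * weighted_tutte_common n d f E \<I>
      = of_nat (fact n) * weighted_tutte_common n d f E' \<I>'"
    using weighted_tutte_hat_iso[OF iso]
    by (simp only: fact_weighted_tutte_common_eq_hat ne matroid_iso_labels_nonempty[OF iso ne] sym
        not_False_eq_True)
  moreover have "(of_nat (fact n) :: real poly poly) \<noteq> 0"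
    by (simp only: of_nat_eq_0_iff fact_nonzero not_False_eq_True)
  ultimately show ?thesis
    by (rule mult_left_cancel[THEN iffD1, rotated])
qed

theorem theorem6p2:
  fixes E :: "'a set" and \<I> :: "'a set set" and n d :: nat and f :: "nat set \<Rightarrow> real"
  assumes "finite_matroid E \<I>" and "card E = n" and "f \<in> Hom n d"
  shows
    "(\<forall>(E' :: 'b set) \<I>'. finite_matroid E' \<I>' \<and> matroid_iso E \<I> E' \<I>' \<longrightarrow>
        weighted_tutte_hat n d f E \<I> = weighted_tutte_hat n d f E' \<I>')
     \<and>
     ((\<forall>s\<in>labels n E. \<forall>t\<in>labels n E.
        weighted_tutte n d (symmetrize n d f) E \<I> s = weighted_tutte n d (symmetrize n d f) E \<I> t)
     \<and> (\<forall>s\<in>labels n E.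
        weighted_tutte n d (symmetrize n d f) E \<I> s
          = weighted_tutte_common n d (symmetrize n d f) E \<I>)
     \<and> (\<forall>(E' :: 'b set) \<I>'. finite_matroid E' \<I>' \<and> matroid_iso E \<I> E' \<I>' \<longrightarrow>
        weighted_tutte_common n d (symmetrize n d f) E \<I>
          = weighted_tutte_common n d (symmetrize n d f) E' \<I>')
     \<and> weighted_tutte_hat n d f E \<I> = weighted_tutte_common n d (symmetrize n d f) E \<I>)
     \<and>
     ((\<forall>\<sigma>. \<sigma> permutes {1..n} \<longrightarrow> perm_act n d \<sigma> f = f) \<longrightarrow>
       (\<forall>s\<in>labels n E. \<forall>t\<in>labels n E.
          weighted_tutte n d f E \<I> s = weighted_tutte n d f E \<I> t)
       \<and> (\<forall>s\<in>labels n E. weighted_tutte n d f E \<I> s = weighted_tutte_common n d f E \<I>)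
       \<and> (\<forall>(E' :: 'b set) \<I>'. finite_matroid E' \<I>' \<and> matroid_iso E \<I> E' \<I>' \<longrightarrow>
          weighted_tutte_common n d f E \<I> = weighted_tutte_common n d f E' \<I>')
       \<and> weighted_tutte_hat n d f E \<I> = of_nat (fact n) * weighted_tutte_common n d f E \<I>)"
proof -
  have ne: "labels n E \<noteq> {}"
    using assms(1,2) by (intro labels_nonempty) (auto simp: finite_matroid_def)
  \<comment> \<open>Both common values are sums over labels, whose invariance is known.\<close>
  have common_sym_iso: "weighted_tutte_common n d (symmetrize n d f) E \<I>
      = weighted_tutte_common n d (symmetrize n d f) E' \<I>'"
    if iso: "matroid_iso E \<I> E' \<I>'" for E' :: "'b set" and \<I>'
    using weighted_tutte_hat_iso[OF iso]
    by (simp only: weighted_tutte_common_symmetrize ne matroid_iso_labels_nonempty[OF iso ne]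
        not_False_eq_True)
  show ?thesis
  proof (intro conjI impI)
    assume "\<forall>\<sigma>. \<sigma> permutes {1..n} \<longrightarrow> perm_act n d \<sigma> f = f"
    then have sym: "\<And>\<sigma>. \<sigma> permutes {1..n} \<Longrightarrow> perm_act n d \<sigma> f = f" by blast
    note eq_common = weighted_tutte_eq_common[OF _ sym, of _ E \<I>]
    show "\<forall>s\<in>labels n E. weighted_tutte n d f E \<I> s = weighted_tutte_common n d f E \<I>"
      using eq_common by blast
    then show "\<forall>s\<in>labels n E. \<forall>t\<in>labels n E.
        weighted_tutte n d f E \<I> s = weighted_tutte n d f E \<I> t"
      by simp
    show "\<forall>(E' :: 'b set) \<I>'. finite_matroid E' \<I>' \<and> matroid_iso E \<I> E' \<I>' \<longrightarrow>
        weighted_tutte_common n d f E \<I> = weighted_tutte_common n d f E' \<I>'"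
      using weighted_tutte_common_iso[OF _ ne sym] by blast
    show "weighted_tutte_hat n d f E \<I> = of_nat (fact n) * weighted_tutte_common n d f E \<I>"
      by (rule fact_weighted_tutte_common_eq_hat[OF ne sym, symmetric])
  next
    show "\<forall>(E' :: 'b set) \<I>'. finite_matroid E' \<I>' \<and> matroid_iso E \<I> E' \<I>' \<longrightarrow>
        weighted_tutte_hat n d f E \<I> = weighted_tutte_hat n d f E' \<I>'"
      using weighted_tutte_hat_iso by blast
  next
    show "\<forall>(E' :: 'b set) \<I>'. finite_matroid E' \<I>' \<and> matroid_iso E \<I> E' \<I>' \<longrightarrow>
        weighted_tutte_common n d (symmetrize n d f) E \<I>
          = weighted_tutte_common n d (symmetrize n d f) E' \<I>'"
      using common_sym_iso by blast
  \<comment> \<open>What is left concerns the symmetrized weight: label independence, agreement with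
    the common value, and equality with \<open>weighted_tutte_hat\<close>. All sides reduce to
    \<open>weighted_tutte_hat n d f E \<I>\<close>.\<close>
  qed (simp_all add: weighted_tutte_symmetrize_eq_hat weighted_tutte_common_symmetrize[OF ne])
qed

end
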